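(* Let $M$ be a monoid and let $\tau$ be any topology on the underlying set of $M$. Then the multiplication $M\times M\to M$ is continuous with respect to the action topology $\tilde\tau$ induced by $\tau$ (with $\tilde\tau\times\tilde\tau$ on the domain).
   Context: For $A\subseteq M$ and $p\in M$ put $p^*(A)=\{m\in M\mid pm\in A\}$ and $\mathcal{I}_A^p=\{m\in M\mid m^*(A)=p^*(A)\}$. The action topology $\tilde\tau$ induced by $\tau$ is the topology on $M$ having as a base the collection $T=\{A\subseteq M\mid\forall p,q\in M,\ \mathcal{I}^p_{q^*(A)}\in\tau\}$ (this is a base of clopen sets, and $\tilde\tau\subseteq\tau$). No compatibility between $\tau$ and the multiplication is assumed. *)

theory Defs
  imports "HOL-Algebra.Group" "HOL-Analysis.Product_Topology"
begin

text \<open>\<open>translate_preimage M p A\<close> is $p^*(A)$ and \<open>translate_class M A p\<close> is $\mathcal{I}_A^p$.\<close>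

definition translate_preimage :: "('a, 'b) monoid_scheme \<Rightarrow> 'a \<Rightarrow> 'a set \<Rightarrow> 'a set" where
  "translate_preimage M p A = {m \<in> carrier M. p \<otimes>\<^bsub>M\<^esub> m \<in> A}"

definition translate_class :: "('a, 'b) monoid_scheme \<Rightarrow> 'a set \<Rightarrow> 'a \<Rightarrow> 'a set" where
  "translate_class M A p =
     {m \<in> carrier M. translate_preimage M m A = translate_preimage M p A}"

definition action_base :: "('a, 'b) monoid_scheme \<Rightarrow> 'a topology \<Rightarrow> 'a set set" where
  "action_base M \<tau> = {A. A \<subseteq> carrier M \<and>
     (\<forall>p \<in> carrier M. \<forall>q \<in> carrier M.
        openin \<tau> (translate_class M (translate_preimage M q A) p))}"

text \<open>The open sets are the unions of members of \<open>action_base M \<tau>\<close>.  The function \<open>topology\<close>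
  is only meaningful on families that satisfy \<open>istopology\<close>; this is what
  \<open>openin_action_topology\<close> below settles.\<close>

definition action_topology :: "('a, 'b) monoid_scheme \<Rightarrow> 'a topology \<Rightarrow> 'a topology" where
  "action_topology M \<tau> = topology (arbitrary union_of (\<lambda>A. A \<in> action_base M \<tau>))"

lemma translate_preimage_Int:
  "translate_preimage M q (A \<inter> B) = translate_preimage M q A \<inter> translate_preimage M q B"
  by (auto simp: translate_preimage_def)

lemma openin_translate_class_Int:
  assumes "\<And>p. p \<in> carrier M \<Longrightarrow> openin \<tau> (translate_class M A p)"
    and "\<And>p. p \<in> carrier M \<Longrightarrow> openin \<tau> (translate_class M B p)"
  shows "openin \<tau> (translate_class M (A \<inter> B) p)"
proof (subst openin_subopen, intro ballI)
  fix m assume m: "m \<in> translate_class M (A \<inter> B) p"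
  then have mc: "m \<in> carrier M" by (simp add: translate_class_def)
  let ?U = "translate_class M A m \<inter> translate_class M B m"
  have "openin \<tau> ?U" using assms mc by blast
  moreover have "m \<in> ?U" using mc by (simp add: translate_class_def)
  moreover have "?U \<subseteq> translate_class M (A \<inter> B) p"
    using m by (auto simp: translate_class_def translate_preimage_Int)
  ultimately show "\<exists>T. openin \<tau> T \<and> m \<in> T \<and> T \<subseteq> translate_class M (A \<inter> B) p" by blast
qed

lemma action_base_Int:
  assumes "A \<in> action_base M \<tau>" "B \<in> action_base M \<tau>"
  shows "A \<inter> B \<in> action_base M \<tau>"
  using assms
  by (simp add: action_base_def translate_preimage_Int le_infI1 openin_translate_class_Int)

lemma openin_action_topology:
  "openin (action_topology M \<tau>) = arbitrary union_of (\<lambda>A. A \<in> action_base M \<tau>)"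
  unfolding action_topology_def
  by (rule topology_inverse', rule istopology_base, rule action_base_Int)

lemma topspace_action_topology:
  assumes "monoid M" "topspace \<tau> = carrier M"
  shows "topspace (action_topology M \<tau>) = carrier M"
proof -
  interpret monoid M by fact
  have pre: "translate_preimage M q (carrier M) = carrier M" if "q \<in> carrier M" for q
    using that by (auto simp: translate_preimage_def)
  have "translate_class M (carrier M) p = topspace \<tau>" if "p \<in> carrier M" for p
    using that assms(2) by (simp add: translate_class_def pre cong: conj_cong)
  then have "carrier M \<in> action_base M \<tau>" by (simp add: action_base_def pre)
  then have "openin (action_topology M \<tau>) (carrier M)"
    unfolding openin_action_topology by (simp add: arbitrary_union_of_inc)
  moreover have "topspace (action_topology M \<tau>) \<subseteq> carrier M"
    unfolding topspace_def openin_action_topology union_of_def action_base_def by blast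
  ultimately show ?thesis using openin_subset by blast
qed

end

theory Submission
  imports Defs
begin

text \<open>Let \<open>A\<close> be a basic open set with $ab \in A$. Then $\mathcal{I}_A^a \times a^*(A)$ is a
  neighbourhood of $(a,b)$ that multiplication maps into \<open>A\<close>: if $m^*(A) = a^*(A)$ and
  $n \in a^*(A)$, then $n \in m^*(A)$, that is, $mn \in A$. Both factors are again basic open,
  because $q^*(a^*(A)) = (aq)^*(A)$, and because $(qm)^*(A) = m^*(q^*(A))$ shows that the
  translates of $q^*(\mathcal{I}_A^a)$ by \<open>m\<close> depend only on $m^*(q^*(A))$.\<close>

lemma translate_preimage_translate_preimage:
  assumes "monoid M" "p \<in> carrier M" "q \<in> carrier M"
  shows "translate_preimage M q (translate_preimage M p A)
    = translate_preimage M (p \<otimes>\<^bsub>M\<^esub> q) A"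
proof -
  interpret monoid M by fact
  show ?thesis using assms(2,3) by (auto simp: translate_preimage_def m_assoc)
qed

lemma openin_action_base:
  "A \<in> action_base M \<tau> \<Longrightarrow> openin (action_topology M \<tau>) A"
  by (simp add: openin_action_topology arbitrary_union_of_inc)

text \<open>The openness condition in \<open>action_base\<close> ranges over all translates of
  \<open>A\<close>; translates of a translate are again translates of \<open>A\<close>, so the
  condition is inherited.\<close>

lemma translate_preimage_in_action_base:
  assumes "monoid M" "A \<in> action_base M \<tau>" "a \<in> carrier M"
  shows "translate_preimage M a A \<in> action_base M \<tau>"
proof -
  interpret monoid M by fact
  show ?thesis
    using assms(2,3)
    by (auto simp: action_base_def translate_preimage_translate_preimage[OF assms(1)])
      (simp add: translate_preimage_def)
qed

text \<open>Serves to make visible that \<open>m\<close> enters the right side only through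
  m^*(q^*(A)).\<close>

lemma translate_preimage_translate_class:
  assumes "monoid M" "q \<in> carrier M"
  shows "translate_preimage M q (translate_class M A a) =
    {m \<in> carrier M. translate_preimage M m (translate_preimage M q A) = translate_preimage M a A}"
proof -
  interpret monoid M by fact
  show ?thesis
    using assms(2)
    \<comment> \<open>Only the outer preimage is unfolded; the others stay folded for the
      composition law.\<close>
    unfolding translate_preimage_def[of M q "translate_class M A a"]
    by (simp add: translate_class_def translate_preimage_translate_preimage[OF assms(1)]
        cong: conj_cong)
qed

text \<open>Each class of a translate by \<open>q\<close> is a union of classes of q^*(A), which are
  open because \<open>A\<close> is basic.\<close>

lemma translate_class_in_action_base:
  assumes "monoid M" "A \<in> action_base M \<tau>"
  shows "translate_class M A a \<in> action_base M \<tau>"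
proof -
  interpret monoid M by fact
  have "openin \<tau> (translate_class M (translate_preimage M q (translate_class M A a)) p)"
    (is "openin \<tau> ?C") if "p \<in> carrier M" and q: "q \<in> carrier M" for p q
  proof (subst openin_subopen, intro ballI)
    let ?B = "translate_preimage M q A"
    \<comment> \<open>The preceding lemma at the product of \<open>q\<close> and
      \<open>m\<close>.\<close>
    have eq: "translate_preimage M m (translate_preimage M q (translate_class M A a))
      = {n \<in> carrier M. translate_preimage M n (translate_preimage M m ?B)
          = translate_preimage M a A}" if "m \<in> carrier M" for m
      using translate_preimage_translate_class[OF assms(1) m_closed[OF q that]]
      by (simp only: translate_preimage_translate_preimage[OF assms(1) q that])
    fix m assume m: "m \<in> ?C"
    then have mc: "m \<in> carrier M" by (simp add: translate_class_def)
    have "openin \<tau> (translate_class M ?B m)"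
      using assms(2) mc q by (simp add: action_base_def)
    moreover have "m \<in> translate_class M ?B m"
      using mc by (simp add: translate_class_def)
    moreover have "translate_class M ?B m \<subseteq> ?C"
    proof
      fix n assume "n \<in> translate_class M ?B m"
      then have "n \<in> carrier M" "translate_preimage M n ?B = translate_preimage M m ?B"
        by (simp_all add: translate_class_def)
      \<comment> \<open>By \<open>eq\<close>, equal translates of \<open>?B\<close> by
        \<open>n\<close> and \<open>m\<close> give equal translates of the set defining
        \<open>?C\<close>; as \<open>m\<close> lies in \<open>?C\<close>, both agree with the one by
        \<open>p\<close>.\<close>
      with m mc eq[of n] eq[of m] show "n \<in> ?C"
        by (simp add: translate_class_def)
    qed
    ultimately show "\<exists>T. openin \<tau> T \<and> m \<in> T \<and> T \<subseteq> ?C" by blast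
  qed
  then show ?thesis by (auto simp: action_base_def) (simp add: translate_class_def)
qed

theorem proposition2p12:
  fixes M :: "('a, 'b) monoid_scheme" and \<tau> :: "'a topology"
  assumes "monoid M" and "topspace \<tau> = carrier M"
  shows "continuous_map
           (prod_topology (action_topology M \<tau>) (action_topology M \<tau>))
           (action_topology M \<tau>)
           (\<lambda>(x, y). x \<otimes>\<^bsub>M\<^esub> y)"
proof -
  interpret monoid M by fact
  let ?T = "action_topology M \<tau>"
  note top = topspace_action_topology[OF assms]
  have "openin (prod_topology ?T ?T)
      {z \<in> topspace (prod_topology ?T ?T). (\<lambda>(x, y). x \<otimes>\<^bsub>M\<^esub> y) z \<in> W}"
    if W: "openin ?T W" for W
  proof (unfold openin_prod_topology_alt, intro allI impI)
    fix a b
    assume "(a, b) \<in> {z \<in> topspace (prod_topology ?T ?T). (\<lambda>(x, y). x \<otimes>\<^bsub>M\<^esub> y) z \<in> W}"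
    then have ab: "a \<in> carrier M" "b \<in> carrier M" "a \<otimes>\<^bsub>M\<^esub> b \<in> W"
      by (simp_all add: top)
    \<comment> \<open>The two factors come from a basic set, so \<open>W\<close> is first shrunk to
      one still containing the product.\<close>
    obtain A where A: "A \<in> action_base M \<tau>" "a \<otimes>\<^bsub>M\<^esub> b \<in> A" "A \<subseteq> W"
      using W ab(3) unfolding openin_action_topology union_of_def by blast
    let ?U = "translate_class M A a" and ?V = "translate_preimage M a A"
    have "openin ?T ?U" "openin ?T ?V"
      using A(1) ab(1) assms(1)
      by (simp_all add: openin_action_base translate_class_in_action_base
          translate_preimage_in_action_base)
    moreover have "a \<in> ?U" "b \<in> ?V"
      using A(2) ab by (simp_all add: translate_class_def translate_preimage_def)
    moreover have "?U \<times> ?V \<subseteq>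
        {z \<in> topspace (prod_topology ?T ?T). (\<lambda>(x, y). x \<otimes>\<^bsub>M\<^esub> y) z \<in> W}"
      using A(3) by (auto simp: top translate_class_def translate_preimage_def)
    ultimately show "\<exists>U V. openin ?T U \<and> openin ?T V \<and> a \<in> U \<and> b \<in> V \<and> U \<times> V \<subseteq>
        {z \<in> topspace (prod_topology ?T ?T). (\<lambda>(x, y). x \<otimes>\<^bsub>M\<^esub> y) z \<in> W}"
      by blast
  qed
  \<comment> \<open>What remains is that products stay in the carrier.\<close>
  then show ?thesis by (auto simp: continuous_map_def top)
qed

end
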